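(* Let $p$ be an odd prime number and let $S=(s_1,\dots,s_n)$ be a finite sequence of elements of $(\mathbb{Z}/p\mathbb{Z})^*=\mathbb{Z}/p\mathbb{Z}\setminus\{0\}$ (repetitions allowed). Let $l_1\geqslant l_2\geqslant\dots\geqslant l_d$ be the list of all common multiplicities of $S$ (one for each pair $\{x,-x\}$ with $x$ or $-x$ occurring in $S$), ordered decreasingly. Then \[|\Sigma(S)|\geqslant\min\left\{p,\,1+\sum_{i=1}^d i\,l_i\right\}\quad\text{and}\quad|\Sigma^*(S)|\geqslant\min\left\{p,\,\sum_{i=1}^d i\,l_i\right\}.\]
   Context: For a sequence $S=(s_1,\dots,s_n)$ in $\mathbb{Z}/p\mathbb{Z}$, $\Sigma(S)=\{\sum_{i\in I}s_i : I\subset[1,n]\}$ (including the empty sum $0$) and $\Sigma^*(S)=\{\sum_{i\in I}s_i:\emptyset\neq I\subset[1,n]\}$. For $x\neq 0$, the common multiplicity of the pair $(x,-x)$ in $S$ is the sum of the multiplicity of $x$ in $S$ and the multiplicity of $-x$ in $S$. *)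

theory Defs
  imports "Berlekamp_Zassenhaus.Finite_Field" "HOL-Library.Multiset"
begin

definition subset_sums :: "'a :: comm_monoid_add list \<Rightarrow> 'a set" where
  "subset_sums S = {\<Sum>i\<in>I. S ! i | I. I \<subseteq> {..<length S}}"

definition nonempty_subset_sums :: "'a :: comm_monoid_add list \<Rightarrow> 'a set" where
  "nonempty_subset_sums S = {\<Sum>i\<in>I. S ! i | I. I \<noteq> {} \<and> I \<subseteq> {..<length S}}"

definition opposite_pairs :: "'a :: ab_group_add list \<Rightarrow> 'a set set" where
  "opposite_pairs S = {{x, - x} | x. x \<in> set S}"

(* Summing over the pair as a set makes this independent of the chosen representative.
   It is the sum of the multiplicities of x and - x because x \<noteq> - x, see below. *)
definition common_multiplicity :: "'a list \<Rightarrow> 'a set \<Rightarrow> nat" where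
  "common_multiplicity S P = (\<Sum>x\<in>P. count_list S x)"

lemma common_multiplicity_pair:
  fixes x :: "'p :: prime_card mod_ring"
  assumes "odd CARD('p)" and "x \<noteq> 0"
  shows "common_multiplicity S {x, - x} = count_list S x + count_list S (- x)"
proof -
  have "x \<noteq> - x"
  proof
    assume "x = - x"
    then have "of_nat 2 * x = 0"
      by (metis mult_2 of_nat_numeral add.right_inverse)
    with assms(2) have "of_nat 2 = (0 :: 'p mod_ring)"
      by simp
    then have "CARD('p) dvd 2"
      by (rule of_nat_0_mod_ring_dvd)
    then have "CARD('p) \<le> 2"
      by (rule dvd_imp_le) simp
    moreover have "CARD('p) > 1"
      using prime_card prime_gt_1_nat by blast
    ultimately show False
      using assms(1) by (metis One_nat_def Suc_leI even_numeral le_antisym numeral_2_eq_2)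
  qed
  then show ?thesis
    by (simp add: common_multiplicity_def)
qed

end

theory Submission
  imports Defs "Jordan_Normal_Form.Determinant" "HOL-Library.FuncSet"
begin

text \<open>
  Split the sequence into layers, each layer containing one term of every pair \<open>{x, -x}\<close> whose
  multiplicity has not yet been used up. By Cauchy--Davenport it suffices to treat one layer, that
  is, a set \<open>A\<close> of \<open>d\<close> elements with \<open>A \<inter> -A = {}\<close>. Up to an affine map, its subset sums are the sums
  \<open>x\<^sub>1 + \<dots> + x\<^sub>d\<close> with \<open>x\<^sub>i \<in> A \<union> -A\<close> and pairwise distinct squares. The polynomial method applied to
  \<open>g(x\<^sub>1 + \<dots> + x\<^sub>d) det(x\<^sub>i\<^bsup>2j\<^esup>)\<close>, with \<open>g\<close> monic of degree \<open>m < p\<close> vanishing on a putative small set of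
  sums, needs a monomial \<open>\<Prod> x\<^sub>i\<^bsup>c\<^sub>i\<^esup>\<close> whose coefficient \<open>m! det(1/(c\<^sub>i - 2j)!)\<close> is nonzero modulo \<open>p\<close>.
  Take for the \<open>c\<^sub>i\<close> the numbers \<open>d-1, \<dots>, 2d-1\<close> with \<open>2d-1-e\<close> omitted. A vector in the kernel of the
  matrix is then a combination of falling factorials of degree at most \<open>d\<close>, without the one of
  degree \<open>e\<close>, that vanishes at \<open>1, 3, \<dots>, 2d-1\<close>. But \<open>(Y-1)(Y-3)\<dots>(Y-2d+1)\<close> expands in falling
  factorials with the coefficients of the Bessel polynomials, which are nonzero modulo \<open>p\<close> as \<open>2d < p\<close>.
  Here \<open>m = d(d-1)/2 + e\<close>. When \<open>e < d\<close>, one of the \<open>c\<^sub>i\<close> equals \<open>d-1\<close>, so that \<open>x\<^sub>i\<close> can be restricted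
  to \<open>A\<close>: the subset sum obtained is then a nonempty one.
\<close>

section \<open>Coefficient extraction by weighted sums over grids\<close>

definition lagrange_weight :: "'a :: field set \<Rightarrow> 'a \<Rightarrow> 'a" where
  "lagrange_weight A a = inverse (\<Prod>b\<in>A - {a}. a - b)"

text \<open>By Lagrange interpolation \<open>q\<close> equals its interpolant on the
  \<open>c + 1\<close> points of \<open>A\<close>; the claim compares the coefficients of degree
  \<open>c\<close>. The weighted sum thus reads off a coefficient from values alone.\<close>

lemma sum_lagrange_weight_poly:
  fixes A :: "'a :: field set"
  assumes "finite A" "card A = Suc c" "degree q \<le> c"
  shows "(\<Sum>a\<in>A. lagrange_weight A a * poly q a) = coeff q c"
proof -
  define Z where "Z a = (\<Prod>b\<in>A - {a}. [:- b, 1:])" for a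
  define r where "r = (\<Sum>a\<in>A. smult (lagrange_weight A a * poly q a) (Z a))"
  have degZ: "degree (Z a) = c" "coeff (Z a) c = 1" if "a \<in> A" for a
  proof -
    have card: "card (A - {a}) = c" using assms that by simp
    show deg: "degree (Z a) = c"
      unfolding Z_def by (subst degree_prod_eq_sum_degree) (auto simp: card)
    have "lead_coeff (Z a) = 1" unfolding Z_def lead_coeff_prod by simp
    with deg show "coeff (Z a) c = 1" by simp
  qed
  have Z0: "poly (Z a) x = 0" if "a \<in> A" "x \<in> A" "x \<noteq> a" for a x
    using that assms(1) by (auto simp: Z_def poly_prod)
  have Z1: "lagrange_weight A a * poly (Z a) a = 1" if "a \<in> A" for a
    using that assms(1) by (auto simp: Z_def poly_prod lagrange_weight_def)
  have "poly r x = poly q x" if "x \<in> A" for x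
  proof -
    have "poly r x = (\<Sum>a\<in>A. lagrange_weight A a * poly q a * poly (Z a) x)"
      by (simp add: r_def poly_sum)
    also have "\<dots> = (\<Sum>a\<in>A. if a = x then poly q x else 0)"
      using Z0 Z1 that by (intro sum.cong) (auto simp: mult_ac)
    finally show ?thesis using that assms(1) by simp
  qed
  moreover have "degree r \<le> c"
    unfolding r_def using degZ by (intro degree_sum_le assms) (auto intro: order.trans[OF degree_smult_le])
  ultimately have "r = q"
    using assms by (intro poly_eqI_degree[of A]) auto
  then have "coeff q c = coeff r c" by simp
  also have "\<dots> = (\<Sum>a\<in>A. lagrange_weight A a * poly q a)"
    unfolding r_def coeff_sum using degZ by (intro sum.cong) auto
  finally show ?thesis ..
qed

lemma sum_lagrange_weight_power:
  fixes A :: "'a :: field set"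
  assumes "finite A" "card A = Suc c" "k \<le> c"
  shows "(\<Sum>a\<in>A. lagrange_weight A a * a ^ k) = (if k = c then 1 else 0)"
  using sum_lagrange_weight_poly[of A c "monom 1 k"] assms
  by (simp add: poly_monom degree_monom_eq)

lemma sum_PiE_insert:
  assumes "i \<notin> I"
  shows "(\<Sum>x\<in>Pi\<^sub>E (insert i I) A. h x) = (\<Sum>a\<in>A i. \<Sum>x\<in>Pi\<^sub>E I A. h (x(i := a)))"
proof -
  have "(\<Sum>x\<in>Pi\<^sub>E (insert i I) A. h x) = (\<Sum>(a, x)\<in>A i \<times> Pi\<^sub>E I A. h (x(i := a)))"
    unfolding PiE_insert_eq using inj_combinator[OF assms]
    by (subst sum.reindex) (auto simp: case_prod_unfold comp_def)
  then show ?thesis by (simp add: sum.cartesian_product)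
qed

text \<open>This is \<open>1/(c - b)!\<close> with the convention that the reciprocal factorial of a
  negative integer is 0; the guard is there because subtraction on naturals truncates.\<close>

definition inverse_fact_diff :: "nat \<Rightarrow> nat \<Rightarrow> 'a :: field" where
  "inverse_fact_diff c b = (if b \<le> c then inverse (of_nat (fact (c - b))) else 0)"

lemma fact_dvd_nonzero:
  assumes "of_nat (fact m) \<noteq> (0 :: 'a :: semiring_1)" "k \<le> m"
  shows "of_nat (fact k) \<noteq> (0 :: 'a)"
  using assms(1) fact_dvd[OF assms(2), where ?'a = nat] by (metis dvdE mult_zero_left of_nat_mult)

text \<open>The weights extract the coefficient of the monomial with exponents \<open>c i\<close>,
  which the multinomial theorem gives. The induction splits off one variable with the binomial
  theorem. Nonvanishing of \<open>fact r\<close> allows multinomial coefficients to be written as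
  quotients in the field.\<close>

lemma grid_sum_power:
  fixes A :: "'i \<Rightarrow> 'a :: field set" and b c :: "'i \<Rightarrow> nat"
  assumes "finite I" and A: "\<And>i. i \<in> I \<Longrightarrow> finite (A i) \<and> card (A i) = Suc (c i)"
    and "r + sum b I \<le> sum c I" and "(of_nat (fact r) :: 'a) \<noteq> 0"
  shows "(\<Sum>x\<in>Pi\<^sub>E I A. (\<Prod>i\<in>I. lagrange_weight (A i) (x i) * x i ^ b i) * (\<Sum>i\<in>I. x i) ^ r)
       = (if r + sum b I = sum c I then of_nat (fact r) * (\<Prod>i\<in>I. inverse_fact_diff (c i) (b i)) else 0)"
  using assms
proof (induction I arbitrary: r rule: finite_induct)
  case empty
  then show ?case by simp
next
  case (insert i I)
  define W where "W x = (\<Prod>j\<in>I. lagrange_weight (A j) (x j) * x j ^ b j)" for x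
  define G where "G k = (\<Sum>x\<in>Pi\<^sub>E I A. W x * (\<Sum>j\<in>I. x j) ^ k)" for k
  define M where "M k = (\<Sum>a\<in>A i. lagrange_weight (A i) a * a ^ k)" for k
  note fact_nz = fact_dvd_nonzero[OF insert.prems(3)]
  have W: "W (x(i := a)) = W x" for x a
    unfolding W_def using insert.hyps by (intro prod.cong) auto
  have S: "(\<Sum>j\<in>I. (x(i := a)) j) = (\<Sum>j\<in>I. x j)" for x :: "'i \<Rightarrow> 'a" and a
    using insert.hyps by (intro sum.cong) auto
  have "(\<Sum>x\<in>Pi\<^sub>E (insert i I) A. (\<Prod>i\<in>insert i I. lagrange_weight (A i) (x i) * x i ^ b i) * (\<Sum>i\<in>insert i I. x i) ^ r)
      = (\<Sum>a\<in>A i. \<Sum>x\<in>Pi\<^sub>E I A. lagrange_weight (A i) a * a ^ b i * W x * (a + (\<Sum>j\<in>I. x j)) ^ r)"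
    using insert.hyps W S
    by (subst sum_PiE_insert)
      (simp_all only: prod.insert sum.insert W_def[symmetric] fun_upd_same mult.assoc refl not_False_eq_True)
  also have "\<dots> = (\<Sum>a\<in>A i. \<Sum>x\<in>Pi\<^sub>E I A. \<Sum>k\<le>r. of_nat (r choose k) * (lagrange_weight (A i) a * a ^ (b i + k)) * (W x * (\<Sum>j\<in>I. x j) ^ (r - k)))"
    by (simp add: binomial_ring sum_distrib_left power_add mult_ac)
  also have "\<dots> = (\<Sum>k\<le>r. of_nat (r choose k) * M (b i + k) * G (r - k))"
    unfolding M_def G_def sum_distrib_left sum_distrib_right
    by (subst sum.swap, subst sum.swap, subst (2) sum.swap) (simp add: mult_ac)
  also have "\<dots> = (\<Sum>k\<le>r. if b i + k = c i \<and> r + sum b (insert i I) = sum c (insert i I)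
      then of_nat (r choose k) * (of_nat (fact (r - k)) * (\<Prod>j\<in>I. inverse_fact_diff (c j) (b j))) else 0)"
  proof (intro sum.cong refl)
    fix k assume k: "k \<in> {..r}"
    \<comment> \<open>The degree bound leaves only the term in which both factors are of exactly the extracted degree.\<close>
    consider "b i + k < c i" | "b i + k \<ge> c i" by linarith
    then show "of_nat (r choose k) * M (b i + k) * G (r - k) = (if b i + k = c i \<and> r + sum b (insert i I) = sum c (insert i I)
      then of_nat (r choose k) * (of_nat (fact (r - k)) * (\<Prod>j\<in>I. inverse_fact_diff (c j) (b j))) else 0)"
    proof cases
      case 1
      then have "M (b i + k) = 0"
        unfolding M_def using insert.prems(1)[of i] by (subst sum_lagrange_weight_power[of _ "c i"]) auto
      with 1 show ?thesis by simp
    next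
      case 2
      have le: "r - k + sum b I \<le> sum c I" "r - k + sum b I = sum c I \<longleftrightarrow> b i + k = c i \<and> r + sum b (insert i I) = sum c (insert i I)"
        using 2 insert.prems(2) insert.hyps k by auto
      have "G (r - k) = (if r - k + sum b I = sum c I then of_nat (fact (r - k)) * (\<Prod>j\<in>I. inverse_fact_diff (c j) (b j)) else 0)"
        unfolding G_def W_def using insert.prems(1) le(1) fact_nz by (intro insert.IH) auto
      moreover have "M (b i + k) = 1" if "b i + k = c i"
        unfolding M_def using insert.prems(1)[of i] that by (subst sum_lagrange_weight_power[of _ "c i"]) auto
      ultimately show ?thesis unfolding le(2) by auto
    qed
  qed
  also have "\<dots> = (if r + sum b (insert i I) = sum c (insert i I) then of_nat (fact r) * (\<Prod>j\<in>insert i I. inverse_fact_diff (c j) (b j)) else 0)"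
  proof (cases "b i \<le> c i \<and> r + sum b (insert i I) = sum c (insert i I)")
    case True
    show ?thesis
    proof (cases "c i - b i \<le> r")
      case le: True
      have "of_nat (r choose (c i - b i)) * of_nat (fact (c i - b i)) * of_nat (fact (r - (c i - b i))) = (of_nat (fact r) :: 'a)"
        using binomial_fact_lemma[OF le] by (metis (no_types, lifting) mult.commute mult.left_commute of_nat_mult)
      moreover have "(of_nat (fact (c i - b i)) :: 'a) \<noteq> 0" using fact_nz le by simp
      ultimately have eq: "of_nat (r choose (c i - b i)) * of_nat (fact (r - (c i - b i))) = (of_nat (fact r) * inverse (of_nat (fact (c i - b i))) :: 'a)"
        by (simp add: field_simps)
      have "b i + k = c i \<longleftrightarrow> k = c i - b i" for k using True by auto
      then have "(\<Sum>k\<le>r. if b i + k = c i \<and> r + sum b (insert i I) = sum c (insert i I)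
          then of_nat (r choose k) * (of_nat (fact (r - k)) * (\<Prod>j\<in>I. inverse_fact_diff (c j) (b j))) else 0)
         = of_nat (r choose (c i - b i)) * of_nat (fact (r - (c i - b i))) * (\<Prod>j\<in>I. inverse_fact_diff (c j) (b j) :: 'a)"
        using True le by (simp add: mult.assoc)
      also have "\<dots> = of_nat (fact r) * (\<Prod>j\<in>insert i I. inverse_fact_diff (c j) (b j))"
        unfolding eq using insert.hyps True by (simp add: inverse_fact_diff_def mult_ac)
      finally show ?thesis using True by simp
    next
      \<comment> \<open>The degree balance now forces \<open>c j < b j\<close> for some
        \<open>j\<close> in \<open>I\<close>, so the product over \<open>I\<close> is 0 and both
        sides vanish.\<close>
      case False
      then have lt: "r + b i < c i" by simp
      then have "sum c I < sum b I" using True insert.hyps by simp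
      then obtain j where j: "j \<in> I" "c j < b j" by (meson not_le sum_mono)
      then have "(\<Prod>j\<in>I. inverse_fact_diff (c j) (b j)) = (0 :: 'a)"
        using insert.hyps by (auto simp: inverse_fact_diff_def intro!: bexI[of _ j])
      then show ?thesis using insert.hyps by (simp only: prod.insert mult_zero_right if_cancel sum.neutral_const if_True not_False_eq_True)
    qed
  next
    case False
    then show ?thesis using insert.hyps by (auto simp: inverse_fact_diff_def)
  qed
  finally show ?case .
qed

lemma grid_sum_poly:
  fixes A :: "'i \<Rightarrow> 'a :: field set" and b c :: "'i \<Rightarrow> nat"
  assumes "finite I" and A: "\<And>i. i \<in> I \<Longrightarrow> finite (A i) \<and> card (A i) = Suc (c i)"
    and m: "m + sum b I = sum c I" "of_nat (fact m) \<noteq> (0 :: 'a)" and g: "degree g \<le> m"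
  shows "(\<Sum>x\<in>Pi\<^sub>E I A. (\<Prod>i\<in>I. lagrange_weight (A i) (x i) * x i ^ b i) * poly g (\<Sum>i\<in>I. x i))
       = coeff g m * of_nat (fact m) * (\<Prod>i\<in>I. inverse_fact_diff (c i) (b i))"
proof -
  have poly_g: "poly g s = (\<Sum>r\<le>m. coeff g r * s ^ r)" for s
    using arg_cong[OF poly_as_sum_of_monoms'[OF g], of "\<lambda>q. poly q s"]
    by (simp add: poly_sum poly_monom)
  have "(\<Sum>x\<in>Pi\<^sub>E I A. (\<Prod>i\<in>I. lagrange_weight (A i) (x i) * x i ^ b i) * poly g (\<Sum>i\<in>I. x i))
      = (\<Sum>x\<in>Pi\<^sub>E I A. \<Sum>r\<le>m. coeff g r * ((\<Prod>i\<in>I. lagrange_weight (A i) (x i) * x i ^ b i) * (\<Sum>i\<in>I. x i) ^ r))"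
    by (simp add: poly_g sum_distrib_left sum_distrib_right mult_ac)
  also have "\<dots> = (\<Sum>r\<le>m. coeff g r * (\<Sum>x\<in>Pi\<^sub>E I A. (\<Prod>i\<in>I. lagrange_weight (A i) (x i) * x i ^ b i) * (\<Sum>i\<in>I. x i) ^ r))"
    unfolding sum_distrib_left by (rule sum.swap)
  also have "\<dots> = (\<Sum>r\<le>m. if r = m then coeff g m * of_nat (fact m) * (\<Prod>i\<in>I. inverse_fact_diff (c i) (b i)) else 0)"
  proof (intro sum.cong refl)
    fix r assume "r \<in> {..m}"
    then show "coeff g r * (\<Sum>x\<in>Pi\<^sub>E I A. (\<Prod>i\<in>I. lagrange_weight (A i) (x i) * x i ^ b i) * (\<Sum>i\<in>I. x i) ^ r)
      = (if r = m then coeff g m * of_nat (fact m) * (\<Prod>i\<in>I. inverse_fact_diff (c i) (b i)) else 0)"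
      using m fact_dvd_nonzero[OF m(2), of r] by (subst grid_sum_power[OF assms(1) A]) auto
  qed
  finally show ?thesis by simp
qed

text \<open>Leibniz expansion: each permutation only rearranges the exponents \<open>b j\<close>, so
  their sum and hence the degree balance is preserved. The extracted coefficients reassemble into a
  determinant.\<close>

lemma grid_sum_alternant:
  fixes A :: "nat \<Rightarrow> 'a :: field set" and b c :: "nat \<Rightarrow> nat"
  assumes A: "\<And>i. i < d \<Longrightarrow> finite (A i) \<and> card (A i) = Suc (c i)"
    and m: "m + (\<Sum>i<d. b i) = (\<Sum>i<d. c i)" "of_nat (fact m) \<noteq> (0 :: 'a)" and g: "degree g \<le> m"
  shows "(\<Sum>x\<in>Pi\<^sub>E {..<d} A. (\<Prod>i<d. lagrange_weight (A i) (x i)) * det (mat d d (\<lambda>(i, j). x i ^ b j)) * poly g (\<Sum>i<d. x i))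
       = coeff g m * of_nat (fact m) * det (mat d d (\<lambda>(i, j). inverse_fact_diff (c i) (b j)))"
proof -
  let ?P = "{p. p permutes {0..<d}}"
  have det: "det (mat d d f) = (\<Sum>p\<in>?P. signof p * (\<Prod>i<d. f (i, p i)))" for f :: "nat \<times> nat \<Rightarrow> 'a"
  proof -
    have "det (mat d d f) = (\<Sum>p\<in>?P. signof p * (\<Prod>i = 0..<d. mat d d f $$ (i, p i)))"
      by (rule det_def') simp
    also have "\<dots> = (\<Sum>p\<in>?P. signof p * (\<Prod>i<d. f (i, p i)))"
      by (intro sum.cong refl arg_cong2[of _ _ _ _ "(*)"] prod.cong)
        (auto simp: lessThan_atLeast0 dest: permutes_in_image)
    finally show ?thesis .
  qed
  have "(\<Sum>x\<in>Pi\<^sub>E {..<d} A. (\<Prod>i<d. lagrange_weight (A i) (x i)) * det (mat d d (\<lambda>(i, j). x i ^ b j)) * poly g (\<Sum>i<d. x i))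
      = (\<Sum>x\<in>Pi\<^sub>E {..<d} A. \<Sum>p\<in>?P. signof p * ((\<Prod>i<d. lagrange_weight (A i) (x i) * x i ^ b (p i)) * poly g (\<Sum>i<d. x i)))"
    unfolding det sum_distrib_left sum_distrib_right prod.distrib by (simp add: mult_ac)
  also have "\<dots> = (\<Sum>p\<in>?P. signof p * (\<Sum>x\<in>Pi\<^sub>E {..<d} A. (\<Prod>i<d. lagrange_weight (A i) (x i) * x i ^ b (p i)) * poly g (\<Sum>i<d. x i)))"
    unfolding sum_distrib_left by (rule sum.swap)
  also have "\<dots> = (\<Sum>p\<in>?P. signof p * (coeff g m * of_nat (fact m) * (\<Prod>i<d. inverse_fact_diff (c i) (b (p i)))))"
  proof (intro sum.cong refl arg_cong2[of _ _ _ _ "(*)"])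
    fix p assume "p \<in> ?P"
    then have "(\<Sum>i<d. b (p i)) = (\<Sum>i<d. b i)"
      using sum.permute[of p "{..<d}" b] by (simp add: lessThan_atLeast0 comp_def)
    with m(1) have "m + (\<Sum>i<d. b (p i)) = (\<Sum>i<d. c i)" by simp
    then show "(\<Sum>x\<in>Pi\<^sub>E {..<d} A. (\<Prod>i<d. lagrange_weight (A i) (x i) * x i ^ b (p i)) * poly g (\<Sum>i<d. x i))
      = coeff g m * of_nat (fact m) * (\<Prod>i<d. inverse_fact_diff (c i) (b (p i)))"
      by (intro grid_sum_poly A m(2) g) auto
  qed
  also have "\<dots> = coeff g m * of_nat (fact m) * det (mat d d (\<lambda>(i, j). inverse_fact_diff (c i) (b j)))"
    unfolding det sum_distrib_left by (simp add: mult_ac)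
  finally show ?thesis .
qed

lemma monic_vanishing_poly:
  fixes C :: "'a :: field set"
  assumes "finite C" "card C \<le> m"
  obtains g where "degree g = m" "coeff g m = 1" "\<And>x. x \<in> C \<Longrightarrow> poly g x = 0"
proof
  \<comment> \<open>The power of the variable pads the degree to exactly \<open>m\<close> when
    \<open>C\<close> is smaller.\<close>
  define g where "g = monom 1 (m - card C) * (\<Prod>x\<in>C. [:- x, 1:])"
  have deg: "degree (\<Prod>x\<in>C. [:- x, 1:]) = card C"
    by (subst degree_prod_eq_sum_degree) auto
  have "degree g = degree (monom (1 :: 'a) (m - card C)) + degree (\<Prod>x\<in>C. [:- x, 1:])"
    unfolding g_def using assms(1) by (intro degree_mult_eq) auto
  then show g: "degree g = m"
    using assms(2) by (simp add: deg Polynomial.degree_monom_eq)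
  have "lead_coeff g = 1"
    unfolding g_def lead_coeff_mult lead_coeff_prod lead_coeff_monom by simp
  with g show "coeff g m = 1" by simp
  show "poly g x = 0" if "x \<in> C" for x
    using assms(1) that by (auto simp: g_def poly_prod)
qed

text \<open>With \<open>g\<close> vanishing on \<open>C\<close>, the weighted grid sum is nonzero,
  so some grid point contributes. There the alternant is nonzero, which excludes equal squares since
  these give equal rows, and \<open>g\<close> is nonzero, which puts the sum outside
  \<open>C\<close>.\<close>

lemma grid_point_avoiding:
  fixes A :: "nat \<Rightarrow> 'a :: field set" and c :: "nat \<Rightarrow> nat"
  assumes A: "\<And>i. i < d \<Longrightarrow> finite (A i) \<and> card (A i) = Suc (c i)"
    and m: "m + (\<Sum>i<d. 2 * i) = (\<Sum>i<d. c i)" "of_nat (fact m) \<noteq> (0 :: 'a)"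
    and det: "det (mat d d (\<lambda>(i, j). inverse_fact_diff (c i) (2 * j))) \<noteq> (0 :: 'a)"
    and C: "finite C" "card C \<le> m"
  obtains x where "x \<in> Pi\<^sub>E {..<d} A" "inj_on (\<lambda>i. (x i)\<^sup>2) {..<d}" "(\<Sum>i<d. x i) \<notin> C"
proof -
  obtain g where g: "degree g = m" "coeff g m = 1" "\<And>x. x \<in> C \<Longrightarrow> poly g x = 0"
    using monic_vanishing_poly[OF C] by blast
  have "(\<Sum>x\<in>Pi\<^sub>E {..<d} A. (\<Prod>i<d. lagrange_weight (A i) (x i)) * det (mat d d (\<lambda>(i, j). x i ^ (2 * j))) * poly g (\<Sum>i<d. x i)) \<noteq> 0"
    using g det m(2) by (subst grid_sum_alternant[OF A m]) auto
  then obtain x where x: "x \<in> Pi\<^sub>E {..<d} A" "det (mat d d (\<lambda>(i, j). x i ^ (2 * j))) \<noteq> 0" "poly g (\<Sum>i<d. x i) \<noteq> 0"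
    by (auto elim!: sum.not_neutral_contains_not_neutral)
  moreover have "inj_on (\<lambda>i. (x i)\<^sup>2) {..<d}"
  proof (rule inj_onI, rule ccontr)
    fix i j assume ij: "i \<in> {..<d}" "j \<in> {..<d}" "(x i)\<^sup>2 = (x j)\<^sup>2" "i \<noteq> j"
    have "det (mat d d (\<lambda>(i, j). x i ^ (2 * j))) = 0"
      using ij by (intro det_identical_rows[of _ d i j]) (auto simp: power_mult)
    with x(2) show False by simp
  qed
  ultimately show ?thesis using g(3) that by blast
qed

section \<open>Falling factorials and Bessel coefficients\<close>

definition falling_poly :: "nat \<Rightarrow> 'a :: field poly" where
  "falling_poly k = (\<Prod>t<k. [:- of_nat t, 1:])"

lemma falling_poly_0 [simp]: "falling_poly 0 = 1"
  and falling_poly_Suc: "falling_poly (Suc k) = falling_poly k * [:- of_nat k, 1:]"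
  by (simp_all add: falling_poly_def)

lemma degree_falling_poly [simp]: "degree (falling_poly k) = k"
  unfolding falling_poly_def by (subst degree_prod_eq_sum_degree) auto

lemma coeff_falling_poly [simp]: "coeff (falling_poly k) k = 1"
proof -
  have "lead_coeff (falling_poly k :: 'a poly) = 1"
    unfolding falling_poly_def lead_coeff_prod by simp
  then show ?thesis by simp
qed

text \<open>Multiplying by the factorial avoids a division that may be illegal in the field. For
  \<open>k > y\<close> it is \<open>fact 0\<close>, and \<open>y\<close> is a root of
  \<open>falling_poly k\<close>.\<close>

lemma falling_poly_of_nat:
  "poly (falling_poly k) (of_nat y) * of_nat (fact (y - k)) = (if k \<le> y then of_nat (fact y) else 0 :: 'a :: field)"
proof (induction k)
  case (Suc k)
  show ?case
  proof (cases "Suc k \<le> y")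
    case True
    then obtain z where z: "y = Suc (k + z)" by (auto simp: le_iff_add)
    then show ?thesis
      using Suc by (simp add: falling_poly_Suc algebra_simps)
  next
    case False
    then have "k = y \<or> k > y" by linarith
    then show ?thesis using Suc by (auto simp: falling_poly_Suc)
  qed
qed simp

lemma falling_poly_independent:
  assumes "(\<Sum>k\<le>n. smult (v k) (falling_poly k)) = (0 :: 'a :: field poly)" "k \<le> n"
  shows "v k = 0"
  using assms
proof (induction n)
  case 0
  then show ?case by simp
next
  case (Suc n)
  have "coeff (\<Sum>k\<le>Suc n. smult (v k) (falling_poly k)) (Suc n) = v (Suc n)"
    by (simp add: coeff_sum coeff_eq_0)
  then have "v (Suc n) = 0" unfolding Suc.prems(1) by simp
  then show ?case using Suc by (cases "k = Suc n") auto
qed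

text \<open>Up to sign, the coefficients of \<open>(Y-1)(Y-3)\<dots>(Y-2d+1)\<close> in the basis of falling factorials.\<close>

fun bessel_coeff :: "nat \<Rightarrow> nat \<Rightarrow> nat" where
  "bessel_coeff 0 k = (if k = 0 then 1 else 0)"
| "bessel_coeff (Suc d) k = (if k = 0 then 0 else bessel_coeff d (k - 1)) + (2 * d + 1 - k) * bessel_coeff d k"

lemma bessel_coeff_eq_0: "d < k \<Longrightarrow> bessel_coeff d k = 0"
  by (induction d arbitrary: k) auto

text \<open>Gives nonvanishing modulo \<open>p\<close>: for \<open>2 * d < p\<close> the prime
  \<open>p\<close> does not divide the right-hand side, hence not \<open>bessel_coeff d k\<close>
  either.\<close>

lemma bessel_coeff_closed_form:
  "k \<le> d \<Longrightarrow> 2 ^ (d - k) * fact (d - k) * fact k * bessel_coeff d k = fact (2 * d - k)"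
proof (induction d arbitrary: k)
  case (Suc d)
  consider "k = Suc d" | "k = 0" | j where "k = Suc j" "j < d"
    using Suc.prems by (cases k) (auto simp: le_Suc_eq less_Suc_eq)
  then show ?case
  proof cases
    case 1
    then show ?thesis using Suc.IH[of d] bessel_coeff_eq_0[of d "Suc d"] by simp
  next
    case 2
    then show ?thesis using Suc.IH[of 0, symmetric] by (simp add: algebra_simps)
  next
    case 3
    \<comment> \<open>Writing \<open>d = j + n + 1\<close> removes all truncated
      subtractions.\<close>
    define n where "n = d - Suc j"
    have d: "d = Suc (j + n)" using 3 by (simp add: n_def)
    have 1: "2 ^ Suc n * fact (Suc n) * fact j * bessel_coeff d j = fact (Suc (Suc (j + 2 * n)))"
      using Suc.IH[of j] by (simp add: d del: fact_Suc)
    have 2: "2 ^ n * fact n * fact (Suc j) * bessel_coeff d (Suc j) = fact (Suc (j + 2 * n))"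
      using Suc.IH[of "Suc j"] by (simp add: d del: fact_Suc bessel_coeff.simps)
    have "2 ^ Suc n * fact (Suc n) * fact (Suc j) * bessel_coeff (Suc d) (Suc j)
        = Suc j * (2 ^ Suc n * fact (Suc n) * fact j * bessel_coeff d j)
        + 2 * Suc n * (Suc (Suc (j + 2 * n))) * (2 ^ n * fact n * fact (Suc j) * bessel_coeff d (Suc j))"
      by (simp add: d algebra_simps del: bessel_coeff.simps(2) add: bessel_coeff.simps(2)[of "Suc (j + n)"])
    \<comment> \<open>Both terms are multiples of \<open>(j + 2n + 2)!\<close>, with factors
      \<open>j + 1\<close> and \<open>2n + 2\<close>, which add up to
      \<open>j + 2n + 3\<close>.\<close>
    also have "\<dots> = fact (Suc (Suc (Suc (j + 2 * n))))"
      unfolding 1 2 by (simp add: algebra_simps)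
    finally show ?thesis by (simp add: 3 d numeral_3_eq_3 del: fact_Suc bessel_coeff.simps)
  qed
qed simp

text \<open>Since \<open>Y - (2d+1) = (Y - k) - (2d+1-k)\<close>, multiplying by the next linear
  factor sends the falling factorial of degree \<open>k\<close> to that of degree
  \<open>k + 1\<close> minus \<open>2d+1-k\<close> times itself. This is the recursion of
  \<open>bessel_coeff\<close> with alternating signs.\<close>

lemma odd_roots_poly_falling_expansion:
  "(\<Prod>j<d. [:- of_nat (2 * j + 1), 1:])
     = (\<Sum>k\<le>d. smult ((- 1) ^ (d + k) * of_nat (bessel_coeff d k)) (falling_poly k) :: 'a :: field poly)"
proof (induction d)
  case 0
  show ?case by simp
next
  case (Suc d)
  let ?s = "\<lambda>d k. (- 1) ^ (d + k) * of_nat (bessel_coeff d k) :: 'a"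
  let ?t = "\<lambda>k. (- 1) ^ (Suc d + k) * of_nat ((2 * d + 1 - k) * bessel_coeff d k) :: 'a"
  have step: "falling_poly k * [:- of_nat (2 * d + 1), 1:]
      = falling_poly (Suc k) + smult (- of_nat (2 * d + 1 - k)) (falling_poly k :: 'a poly)" if "k \<le> d" for k
  proof -
    have "[:- of_nat (2 * d + 1), 1:] = [:- of_nat k, 1:] + [:- of_nat (2 * d + 1 - k) :: 'a:]"
      using that by (simp add: of_nat_diff)
    then show ?thesis by (simp only: falling_poly_Suc distrib_left) simp
  qed
  have "(\<Prod>j<Suc d. [:- of_nat (2 * j + 1), 1:])
      = (\<Sum>k\<le>d. smult (?s d k) (falling_poly k * [:- of_nat (2 * d + 1), 1:]))"
    unfolding prod.lessThan_Suc Suc by (simp only: sum_distrib_right mult_smult_left)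
  also have "\<dots> = (\<Sum>k\<le>d. smult (?s d k) (falling_poly (Suc k)) + smult (?t k) (falling_poly k))"
    by (intro sum.cong refl)
      (simp only: step atMost_iff smult_add_right smult_smult of_nat_mult power_Suc add_Suc mult_minus_left mult_minus_right mult_1 mult.assoc mult.commute[of "of_nat (bessel_coeff d _)"])
  also have "\<dots> = (\<Sum>k\<le>d. smult (?s d k) (falling_poly (Suc k))) + (\<Sum>k\<le>Suc d. smult (?t k) (falling_poly k))"
    by (simp only: sum.distrib sum.atMost_Suc bessel_coeff_eq_0[OF lessI] mult_0_right mult_zero_right of_nat_0 smult_0_left add_0_right)
  also have "\<dots> = (\<Sum>k\<le>Suc d. smult (?s (Suc d) k) (falling_poly k))"
  proof -
    have "?s (Suc d) 0 = ?t 0" "?s (Suc d) (Suc k) = ?s d k + ?t (Suc k)" for k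
      by (simp_all add: distrib_left)
    then show ?thesis
      by (simp only: sum.atMost_Suc_shift smult_add_left sum.distrib add_ac)
  qed
  finally show ?case .
qed

section \<open>Nonvanishing of the determinant modulo p\<close>

lemma of_nat_mod_ring_eq_0_iff: "of_nat n = (0 :: 'p :: prime_card mod_ring) \<longleftrightarrow> CARD('p) dvd n"
  by (simp add: of_nat_eq_0_iff_char_dvd)

lemma of_nat_fact_mod_ring_nonzero: "m < CARD('p) \<Longrightarrow> of_nat (fact m) \<noteq> (0 :: 'p :: prime_card mod_ring)"
  using prime_card[where ?'a = 'p] by (simp add: of_nat_mod_ring_eq_0_iff prime_dvd_fact_iff del: of_nat_fact)

lemma inj_on_of_nat_mod_ring: "inj_on (of_nat :: nat \<Rightarrow> 'p :: prime_card mod_ring) {..<CARD('p)}"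
proof (rule linorder_inj_onI)
  fix x y assume "x < y" "x \<in> {..<CARD('p)}" "y \<in> {..<CARD('p)}"
  then have "of_nat (y - x) \<noteq> (0 :: 'p mod_ring)"
    unfolding of_nat_mod_ring_eq_0_iff by (auto dest: dvd_imp_le)
  with \<open>x < y\<close> show "of_nat x \<noteq> (of_nat y :: 'p mod_ring)" by (simp add: of_nat_diff)
qed auto

text \<open>\<open>(N-b)!/(c-b)!\<close> is a falling factorial of \<open>N - b\<close> with
  \<open>N - c\<close> factors. So scaling column \<open>b\<close> by \<open>(N-b)!\<close> turns
  the matrix into values of falling factorials: rows give degrees, columns give points.\<close>

lemma inverse_fact_diff_eq_falling_poly:
  assumes "c \<le> N" "b \<le> N" "of_nat (fact N) \<noteq> (0 :: 'a :: field)"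
  shows "inverse_fact_diff c b * of_nat (fact (N - b)) = poly (falling_poly (N - c)) (of_nat (N - b) :: 'a)"
proof (cases "b \<le> c")
  case True
  have "of_nat (fact (c - b)) \<noteq> (0 :: 'a)"
    using assms by (intro fact_dvd_nonzero[OF assms(3)]) simp
  moreover have "N - b - (N - c) = c - b" "N - c \<le> N - b" using assms True by auto
  ultimately show ?thesis
    using falling_poly_of_nat[of "N - c" "N - b", where ?'a = 'a] True
    by (simp add: inverse_fact_diff_def field_simps)
next
  case False
  then have "N - b - (N - c) = 0" "\<not> N - c \<le> N - b" using assms by auto
  then show ?thesis
    using falling_poly_of_nat[of "N - c" "N - b", where ?'a = 'a] False
    by (simp add: inverse_fact_diff_def)
qed

lemma det_inverse_fact_diff_nonzero:
  assumes d: "2 * d < CARD('p :: prime_card)" and e: "e \<le> d"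
    and c: "\<And>i. i < d \<Longrightarrow> c i = (if i < d - e then d - 1 + i else d + i)"
  shows "det (mat d d (\<lambda>(i, j). inverse_fact_diff (c i) (2 * j))) \<noteq> (0 :: 'p mod_ring)"
proof
  define M where "M = mat d d (\<lambda>(i, j). inverse_fact_diff (c i) (2 * j) :: 'p mod_ring)"
  define N where "N = 2 * d - 1"
  define q where "q k = (- 1) ^ (d + k) * (of_nat (bessel_coeff d k) :: 'p mod_ring)" for k
  assume "det (mat d d (\<lambda>(i, j). inverse_fact_diff (c i) (2 * j))) = (0 :: 'p mod_ring)"
  \<comment> \<open>Transposing yields a dependency among the rows, that is, among polynomials of
    different degrees.\<close>
  then have "det (transpose_mat M) = 0"
    unfolding M_def by (subst det_transpose[of _ d]) auto
  then obtain u where u: "u \<in> carrier_vec d" "u \<noteq> 0\<^sub>v d" "transpose_mat M *\<^sub>v u = 0\<^sub>v d"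
    using det_0_iff_vec_prod_zero_field[of "transpose_mat M" d] by (auto simp: M_def)
  have kernel: "(\<Sum>i<d. inverse_fact_diff (c i) (2 * j) * u $ i) = 0" if "j < d" for j
  proof -
    have "(transpose_mat M *\<^sub>v u) $ j = (\<Sum>i<d. inverse_fact_diff (c i) (2 * j) * u $ i)"
      using that u(1) by (simp add: M_def scalar_prod_def lessThan_atLeast0)
    then show ?thesis using u(3) that by simp
  qed
  \<comment> \<open>The degrees \<open>N - c i\<close> run exactly through \<open>0, ..., d\<close>
    without \<open>e\<close>; \<open>v\<close> below is \<open>u\<close> reindexed by degree, so
    \<open>v e = 0\<close>.\<close>
  have cN: "N - c i \<le> d" "N - c i \<noteq> e" "c i \<le> N" if "i < d" for i
    using that e by (auto simp: c N_def)
  have c_inj: "N - c i = N - c j \<longleftrightarrow> i = j" if "i < d" "j < d" for i j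
    using that by (auto simp: c N_def)
  define v where "v k = (\<Sum>i<d. if N - c i = k then u $ i else 0)" for k
  define R where "R = (\<Sum>k\<le>d. smult (v k) (falling_poly k))"
  have R: "R = (\<Sum>i<d. smult (u $ i) (falling_poly (N - c i)))"
  proof -
    have "R = (\<Sum>k\<le>d. \<Sum>i<d. if N - c i = k then smult (u $ i) (falling_poly k) else 0)"
      unfolding R_def v_def smult_sum by (intro sum.cong refl) (auto intro!: sum.cong)
    also have "\<dots> = (\<Sum>i<d. \<Sum>k\<le>d. if N - c i = k then smult (u $ i) (falling_poly k) else 0)"
      by (rule sum.swap)
    finally show ?thesis using cN(1) by simp
  qed
  have root: "poly R (of_nat (2 * j + 1)) = 0" if "j < d" for j
  proof -
    \<comment> \<open>Column \<open>d - 1 - j\<close> is the one whose evaluation point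
      \<open>N - b\<close> is \<open>2 * j + 1\<close>.\<close>
    define b where "b = 2 * (d - 1 - j)"
    have b: "b \<le> N" "N - b = 2 * j + 1" using that by (auto simp: b_def N_def)
    have "of_nat (fact N) \<noteq> (0 :: 'p mod_ring)"
      using d by (intro of_nat_fact_mod_ring_nonzero) (simp add: N_def)
    then have "poly (falling_poly (N - c i)) (of_nat (2 * j + 1)) = inverse_fact_diff (c i) b * (of_nat (fact (N - b)) :: 'p mod_ring)" if "i < d" for i
      using inverse_fact_diff_eq_falling_poly[of "c i" N b] cN(3)[OF that] b by (metis (no_types))
    then have "poly R (of_nat (2 * j + 1)) = (\<Sum>i<d. inverse_fact_diff (c i) b * u $ i) * of_nat (fact (N - b))"
      unfolding R poly_sum sum_distrib_right by (intro sum.cong refl) (simp add: mult_ac del: of_nat_fact)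
    then show ?thesis using kernel[of "d - 1 - j"] that by (simp add: b_def)
  qed
  define Q :: "'p mod_ring poly" where "Q = (\<Prod>j<d. [:- of_nat (2 * j + 1), 1:])"
  have Q: "Q = (\<Sum>k\<le>d. smult (q k) (falling_poly k))"
    unfolding Q_def q_def by (rule odd_roots_poly_falling_expansion)
  have degQ: "degree Q = d"
    unfolding Q_def by (subst degree_prod_eq_sum_degree) auto
  have "lead_coeff Q = 1" unfolding Q_def lead_coeff_prod by simp
  then have coeffQ: "coeff Q d = 1" using degQ by simp
  have rootQ: "poly Q (of_nat (2 * j + 1)) = 0" if "j < d" for j
    using that by (auto simp: Q_def poly_prod intro!: bexI[of _ j])
  have coeffR: "coeff R d = v d"
  proof -
    have "coeff R d = (\<Sum>k\<le>d. if k = d then v d else 0)"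
      unfolding R_def coeff_sum by (intro sum.cong refl) (auto simp: coeff_eq_0)
    then show ?thesis by simp
  qed
  \<comment> \<open>Both sides have degree at most \<open>d\<close>, the same coefficient of degree
    \<open>d\<close>, and vanish at the \<open>d\<close> odd points, which are distinct modulo
    \<open>p\<close> because \<open>2 * d < p\<close>.\<close>
  have "R = smult (v d) Q"
  proof (rule poly_eqI_degree_lead_coeff[where A = "of_nat ` (\<lambda>j. 2 * j + 1) ` {..<d}"])
    have "inj_on (of_nat :: nat \<Rightarrow> 'p mod_ring) ((\<lambda>j. 2 * j + 1) ` {..<d})"
      using d by (intro inj_on_subset[OF inj_on_of_nat_mod_ring]) auto
    then have "card ((of_nat :: nat \<Rightarrow> 'p mod_ring) ` (\<lambda>j. 2 * j + 1) ` {..<d}) = d"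
      by (simp add: card_image inj_on_def)
    then show "d \<le> card ((of_nat :: nat \<Rightarrow> 'p mod_ring) ` (\<lambda>j. 2 * j + 1) ` {..<d})" by simp
    show "degree R \<le> d"
      unfolding R_def by (intro degree_sum_le) (auto intro: order.trans[OF degree_smult_le])
    show "degree (smult (v d) Q) \<le> d" using degQ degree_smult_le by metis
    show "coeff R d = coeff (smult (v d) Q) d" using coeffQ coeffR by simp
    show "poly R z = poly (smult (v d) Q) z" if "z \<in> of_nat ` (\<lambda>j. 2 * j + 1) ` {..<d}" for z
      using that root rootQ by (auto simp del: of_nat_Suc of_nat_add)
  qed
  then have "(\<Sum>k\<le>d. smult (v k - v d * q k) (falling_poly k)) = 0"
    unfolding R_def Q smult_diff_left sum_subtractf by (simp add: smult_sum2)
  then have v: "v k = v d * q k" if "k \<le> d" for k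
    using falling_poly_independent[of "\<lambda>k. v k - v d * q k" d k] that by simp
  have "v e = 0" unfolding v_def using cN(2) by (intro sum.neutral) auto
  moreover have "q e \<noteq> 0"
  proof -
    have "of_nat (fact (2 * d - e)) \<noteq> (0 :: 'p mod_ring)"
      using d by (intro of_nat_fact_mod_ring_nonzero) simp
    then have "of_nat (bessel_coeff d e) \<noteq> (0 :: 'p mod_ring)"
      unfolding bessel_coeff_closed_form[OF e, symmetric] of_nat_mult by auto
    then show ?thesis by (simp add: q_def)
  qed
  ultimately have "v d = 0" using v[OF e] by simp
  then have v0: "v k = 0" if "k \<le> d" for k using v[OF that] by simp
  have "u $ i = 0" if "i < d" for i
  proof -
    have "v (N - c i) = (\<Sum>j<d. if j = i then u $ i else 0)"
      unfolding v_def using that by (intro sum.cong refl) (auto simp: c_inj)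
    then show ?thesis using that v0[OF cN(1)[OF that]] by simp
  qed
  then have "u = 0\<^sub>v d" using u(1) by (intro eq_vecI) auto
  with u(2) show False by simp
qed

section \<open>Subset sums of a single layer\<close>

text \<open>The set \<open>Y\<close> contains exactly one of \<open>a\<close> and \<open>-a\<close> for every \<open>a \<in> A\<close>.\<close>

lemma sum_signed_transversal:
  fixes A Y :: "'a :: comm_ring_1 set"
  assumes "finite A" "Y \<subseteq> A \<union> uminus ` A" "card Y = card A" "inj_on power2 Y"
  shows "\<Sum>Y = 2 * \<Sum>(Y \<inter> A) - \<Sum>A"
proof -
  \<comment> \<open>\<open>\<phi> y\<close> is the member of \<open>A\<close> in the pair of
    \<open>y\<close>, so \<open>y + \<phi> y\<close> is \<open>2 * y\<close> on \<open>A\<close> and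
    0 elsewhere.\<close>
  define \<phi> where "\<phi> y = (if y \<in> A then y else - y)" for y
  have "inj_on \<phi> Y"
    using assms(4) by (auto simp: inj_on_def \<phi>_def split: if_splits)
  moreover have "\<phi> ` Y \<subseteq> A" using assms(2) by (auto simp: \<phi>_def)
  ultimately have "bij_betw \<phi> Y A"
    using assms by (simp add: bij_betw_def card_image card_subset_eq)
  then have "\<Sum>A = (\<Sum>y\<in>Y. \<phi> y)" by (simp add: sum.reindex_bij_betw[symmetric])
  moreover have "finite Y" using assms(1,2) by (meson finite_UnI finite_imageI finite_subset)
  then have "(\<Sum>y\<in>Y. y + \<phi> y) = (\<Sum>y\<in>Y. if y \<in> A then 2 * y else 0)"
    by (intro sum.cong) (auto simp: \<phi>_def)
  then have "(\<Sum>y\<in>Y. y + \<phi> y) = 2 * \<Sum>(Y \<inter> A)"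
    using \<open>finite Y\<close> by (simp add: sum.inter_restrict sum_distrib_left if_distrib cong: if_cong)
  ultimately show ?thesis by (simp add: sum.distrib algebra_simps)
qed

lemma two_times_sum_lessThan: "2 * (\<Sum>i<d. i) = d * (d - 1 :: nat)"
proof (induction d)
  case (Suc d)
  then show ?case by (cases d) auto
qed simp

text \<open>With \<open>d = card A\<close>, the choice \<open>e = d\<close> gives the sharp bound
  for all subset sums and \<open>e = d - 1\<close> the one for nonempty subsets. Smaller
  \<open>e\<close> serves when \<open>p\<close> is too small for these.\<close>

lemma card_set_subset_sums_step:
  fixes A :: "'p :: prime_card mod_ring set"
  assumes A: "A \<inter> uminus ` A = {}"
    and e: "e \<le> card A" and m: "(\<Sum>i<card A. i) + e < CARD('p)"
  shows "(\<Sum>i<card A. i) + e < card (Sum ` (if e < card A then Pow A - {{}} else Pow A))"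
proof (cases "A = {}")
  case True
  then show ?thesis using e by simp
next
  case False
  define d where "d = card A"
  define m' where "m' = (\<Sum>i<d. i) + e"
  define X where "X = (if e < d then Pow A - {{}} else Pow A)"
  define c where "c i = (if i < d - e then d - 1 + i else d + i)" for i
  define B where "B = A \<union> uminus ` A"
  have d0: "d > 0" using False by (simp add: d_def card_gt_0_iff)
  have cardB: "card B = 2 * d"
    unfolding B_def using A by (subst card_Un_disjoint) (auto simp: d_def card_image)
  \<comment> \<open>Since \<open>B\<close> misses 0, its \<open>2 * d\<close> elements give
    \<open>2 * d < p\<close>, as the determinant lemma requires.\<close>
  have "0 \<notin> A" using A by force
  then have "0 \<notin> B" by (auto simp: B_def)
  then have "card B < card (UNIV :: 'p mod_ring set)" by (intro psubset_card_mono) auto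
  then have d: "2 * d < CARD('p)" using cardB by simp
  \<comment> \<open>The grid sides are arbitrary subsets of \<open>B\<close> of the right size,
    except that for \<open>e < d\<close> the first has size \<open>c 0 + 1 = d\<close> and can be
    \<open>A\<close> itself.\<close>
  have "\<exists>D. D \<subseteq> B \<and> card D = Suc (c i) \<and> (i = 0 \<and> e < d \<longrightarrow> D = A)" if "i < d" for i
  proof (cases "i = 0 \<and> e < d")
    case True
    then show ?thesis using d0 by (intro exI[of _ A]) (auto simp: B_def c_def d_def)
  next
    case False
    have "Suc (c i) \<le> card B" using that by (auto simp: c_def cardB)
    then show ?thesis using False by (metis obtain_subset_with_card_n)
  qed
  then obtain D where D: "\<And>i. i < d \<Longrightarrow> D i \<subseteq> B \<and> card (D i) = Suc (c i) \<and> (i = 0 \<and> e < d \<longrightarrow> D i = A)"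
    by metis
  have sum_c: "m' + (\<Sum>i<d. 2 * i) = (\<Sum>i<d. c i)"
  proof -
    have "(\<Sum>i<d. c i) = (\<Sum>i<d. d - 1 + i + (if i \<in> {d - e..<d} then 1 else 0))"
      using d0 by (intro sum.cong) (auto simp: c_def)
    also have "\<dots> = d * (d - 1) + (\<Sum>i<d. i) + (\<Sum>i<d. if i \<in> {d - e..<d} then 1 else 0)"
      by (simp only: sum.distrib sum_constant card_lessThan of_nat_id)
    also have "(\<Sum>i<d. if i \<in> {d - e..<d} then 1 else 0) = card ({..<d} \<inter> {d - e..<d})"
      by (subst sum.inter_restrict[symmetric]) auto
    also have "{..<d} \<inter> {d - e..<d} = {d - e..<d}" by auto
    finally show ?thesis
      using e two_times_sum_lessThan[of d] by (simp add: m'_def d_def sum_distrib_left)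
  qed
  have "m' < card (Sum ` X)"
  proof (rule ccontr)
    assume "\<not> m' < card (Sum ` X)"
    \<comment> \<open>If \<open>s\<close> is the sum of \<open>Y \<inter> A\<close>, this affine map
      sends it to the sum of the signed transversal \<open>Y\<close>.\<close>
    define C where "C = (\<lambda>s. 2 * s - \<Sum>A) ` Sum ` X"
    have "card C \<le> m'"
      unfolding C_def using \<open>\<not> m' < _\<close> card_image_le[of "Sum ` X" "\<lambda>s. 2 * s - \<Sum>A"] by simp
    moreover have "det (mat d d (\<lambda>(i, j). inverse_fact_diff (c i) (2 * j))) \<noteq> (0 :: 'p mod_ring)"
      using d e by (intro det_inverse_fact_diff_nonzero[of d e]) (auto simp: c_def d_def)
    moreover have "of_nat (fact m') \<noteq> (0 :: 'p mod_ring)"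
      using m by (intro of_nat_fact_mod_ring_nonzero) (simp add: m'_def d_def)
    ultimately obtain x where x: "x \<in> Pi\<^sub>E {..<d} D" "inj_on (\<lambda>i. (x i)\<^sup>2) {..<d}" "(\<Sum>i<d. x i) \<notin> C"
      using grid_point_avoiding[of d D c m' C] D sum_c by auto
    define Y where "Y = x ` {..<d}"
    have inj: "inj_on x {..<d}" using x(2) by (auto simp: inj_on_def)
    have "\<Sum>Y = 2 * \<Sum>(Y \<inter> A) - \<Sum>A"
    proof (rule sum_signed_transversal)
      show "Y \<subseteq> A \<union> uminus ` A" using x(1) D unfolding Y_def B_def by (fastforce simp: PiE_iff)
      show "card Y = card A" using inj by (simp add: Y_def card_image d_def)
      show "inj_on power2 Y" using x(2) by (auto simp: Y_def inj_on_def)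
    qed simp
    moreover have "(\<Sum>i<d. x i) = \<Sum>Y" using inj by (simp add: Y_def sum.reindex)
    moreover have "Y \<inter> A \<in> X"
    proof (cases "e < d")
      case True
      then have "x 0 \<in> Y \<inter> A" using x(1) D[OF d0] d0 by (auto simp: Y_def PiE_iff)
      then show ?thesis using True by (auto simp: X_def)
    qed (auto simp: X_def)
    ultimately show False using x(3) by (auto simp: C_def)
  qed
  then show ?thesis by (simp add: m'_def d_def X_def)
qed

lemma sum_atLeast1_eq_lessThan: "(\<Sum>i = 1..d. i) = (\<Sum>i<d. i) + (d :: nat)"
  by (induction d) auto

text \<open>If the full bound stays below \<open>p\<close>, \<open>e = d\<close> and
  \<open>e = d - 1\<close> suffice. If \<open>p\<close> is reached between \<open>?s\<close> and
  \<open>?s + ?d\<close>, then \<open>e = p - 1 - ?s\<close> makes the nonempty sums cover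
  everything. If already \<open>?s \<ge> p\<close>, one element is dropped and induction
  applies.\<close>

lemma card_set_subset_sums:
  fixes A :: "'p :: prime_card mod_ring set"
  assumes A: "A \<inter> uminus ` A = {}"
  shows "min CARD('p) (1 + (\<Sum>i = 1..card A. i)) \<le> card (Sum ` Pow A)
    \<and> min CARD('p) (\<Sum>i = 1..card A. i) \<le> card (Sum ` (Pow A - {{}}))"
  using A
proof (induction "card A" arbitrary: A)
  case 0
  then have "A = {}" by simp
  then show ?case by simp
next
  case (Suc n)
  let ?p = "CARD('p)" and ?d = "card A" and ?s = "\<Sum>i<card A. i"
  note step = card_set_subset_sums_step[OF Suc.prems]
  have mono: "card (Sum ` (Pow B - {{}})) \<le> card (Sum ` (Pow A - {{}}))" "card (Sum ` Pow B) \<le> card (Sum ` Pow A)"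
    if "B \<subseteq> A" for B
    using that by (auto intro!: card_mono)
  have le: "card (Sum ` (Pow A - {{}})) \<le> card (Sum ` Pow A)" by (intro card_mono) auto
  consider "?s + ?d < ?p" | "?s < ?p" "?p \<le> ?s + ?d" | "?p \<le> ?s" by linarith
  then show ?case
  proof cases
    case 1
    then show ?thesis
      unfolding sum_atLeast1_eq_lessThan using step[of ?d] step[of n] Suc.hyps(2)[symmetric] by simp
  next
    case 2
    then have "?s + (?p - 1 - ?s) = ?p - 1" "?p - 1 - ?s < ?d" "?p - 1 < ?p" by auto
    then have "?p - 1 < card (Sum ` (Pow A - {{}}))" using step[of "?p - 1 - ?s"] by simp
    then show ?thesis using le by linarith
  next
    case 3
    obtain a where a: "a \<in> A" using Suc.hyps(2) by fastforce
    then have n: "card (A - {a}) = n" using Suc.hyps(2) by simp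
    have "(\<Sum>i = 1..n. i) = ?s" unfolding sum_atLeast1_eq_lessThan Suc.hyps(2)[symmetric] by simp
    moreover have "min ?p (1 + (\<Sum>i = 1..n. i)) \<le> card (Sum ` Pow (A - {a}))
      \<and> min ?p (\<Sum>i = 1..n. i) \<le> card (Sum ` (Pow (A - {a}) - {{}}))"
      using Suc.hyps(1)[of "A - {a}"] Suc.prems n by auto
    ultimately show ?thesis using 3 mono[of "A - {a}"] by auto
  qed
qed

section \<open>Cauchy-Davenport and assembly of the layers\<close>

text \<open>The same grid method with two variables and no determinant: the extracted coefficient
  \<open>m!/(c 0! c 1!)\<close> is nonzero because \<open>m < p\<close>.\<close>

lemma cauchy_davenport:
  fixes A B :: "'p :: prime_card mod_ring set"
  assumes "A \<noteq> {}" "B \<noteq> {}"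
  shows "min CARD('p) (card A + card B - 1) \<le> card ((\<lambda>(a, b). a + b) ` (A \<times> B))"
proof -
  let ?p = "CARD('p)"
  have pos: "card A > 0" "card B > 0" using assms by (simp_all add: card_gt_0_iff)
  have "card A \<le> card (UNIV :: 'p mod_ring set)" by (intro card_mono) auto
  then have "card A \<le> ?p" by simp
  \<comment> \<open>Shrinking \<open>B\<close> keeps \<open>card A + card B' - 1\<close> at most
    \<open>p\<close>, so that \<open>m < p\<close>.\<close>
  then obtain B' where B': "B' \<subseteq> B" "card B' = min (card B) (?p + 1 - card A)"
    by (metis min.cobounded1 obtain_subset_with_card_n)
  define c where "c i = (if i = 0 then card A - 1 else card B' - 1)" for i :: nat
  define D where "D i = (if i = 0 then A else B')" for i :: nat
  define m where "m = c 0 + c 1"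
  have B'pos: "card B' > 0" using B' pos \<open>card A \<le> ?p\<close> by simp
  have m: "Suc m = min ?p (card A + card B - 1)" "m < ?p"
    using B' pos \<open>card A \<le> ?p\<close> by (auto simp: m_def c_def)
  have "m < card ((\<lambda>(a, b). a + b) ` (A \<times> B'))" (is "m < card ?C")
  proof (rule ccontr)
    assume "\<not> m < card ?C"
    then obtain g where g: "degree g = m" "coeff g m = 1" "\<And>x. x \<in> ?C \<Longrightarrow> poly g x = 0"
      using monic_vanishing_poly[of ?C m] by auto
    have "(\<Sum>x\<in>Pi\<^sub>E {0, 1} D. (\<Prod>i\<in>{0, 1}. lagrange_weight (D i) (x i) * x i ^ 0) * poly g (\<Sum>i\<in>{0, 1}. x i))
        = coeff g m * of_nat (fact m) * (\<Prod>i\<in>{0, 1}. inverse_fact_diff (c i) 0)"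
      using pos B'pos m(2) g(1) by (intro grid_sum_poly of_nat_fact_mod_ring_nonzero) (auto simp: m_def c_def D_def)
    moreover have "poly g (\<Sum>i\<in>{0, 1}. x i) = 0" if "x \<in> Pi\<^sub>E {0, 1} D" for x
      using that by (intro g(3)) (auto simp: D_def PiE_iff image_iff intro!: bexI[of _ "(x 0, x 1)"])
    moreover have "of_nat (fact k) \<noteq> (0 :: 'p mod_ring)" if "k \<le> m" for k
      using that m(2) by (intro of_nat_fact_mod_ring_nonzero) simp
    ultimately show False using g(2) by (simp add: inverse_fact_diff_def m_def del: of_nat_fact)
  qed
  also have "card ?C \<le> card ((\<lambda>(a, b). a + b) ` (A \<times> B))"
    using B'(1) by (intro card_mono) auto
  finally show ?thesis using m(1) by simp
qed

text \<open>Induction on the bound \<open>K\<close> for the multiplicities: one layer is peeled off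
  and the rest added by Cauchy-Davenport. The \<open>k\<close>-th summand belongs to the layer of
  pairs with multiplicity at least \<open>k\<close>. Index sets replace lists so that a layer is
  just a subset.\<close>

lemma card_indexed_subset_sums:
  fixes s :: "'i \<Rightarrow> 'p :: prime_card mod_ring"
  defines "f \<equiv> \<lambda>i. {s i, - s i}"
  assumes odd: "odd CARD('p)"
    and "finite I" "\<And>i. i \<in> I \<Longrightarrow> s i \<noteq> 0" "\<And>P. P \<in> f ` I \<Longrightarrow> card {i \<in> I. f i = P} \<le> K"
  shows "min CARD('p) (1 + (\<Sum>k = 1..K. \<Sum>i = 1..card {P \<in> f ` I. k \<le> card {i \<in> I. f i = P}}. i)) \<le> card (sum s ` Pow I)
    \<and> min CARD('p) (\<Sum>k = 1..K. \<Sum>i = 1..card {P \<in> f ` I. k \<le> card {i \<in> I. f i = P}}. i) \<le> card (sum s ` (Pow I - {{}}))"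
  using assms(3-)
proof (induction K arbitrary: I)
  case 0
  have "{j \<in> I. f j = f i} = {}" if "i \<in> I" for i
    using 0(3)[of "f i"] 0(1) that by simp
  then have "I = {}" by blast
  then show ?case by simp
next
  case (Suc K)
  define fib where "fib I P = {i \<in> I. f i = P}" for I P
  define T where "T I k = (\<Sum>i = 1..card {P \<in> f ` I. k \<le> card (fib I P)}. i :: nat)" for I k
  \<comment> \<open>\<open>J\<close> selects one index from each pair, forming the first
    layer.\<close>
  obtain J where J: "J \<subseteq> I" "inj_on f J" "f ` J = f ` I"
    by (metis order_refl subset_image_inj)
  define I' where "I' = I - J"
  have fin: "finite J" "finite I'" "finite (fib I P)" for P
    using J(1) Suc.prems(1) by (auto simp: I'_def fib_def intro: finite_subset)
  have fib: "card (fib I P) = Suc (card (fib I' P))" if P: "P \<in> f ` I" for P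
  proof -
    obtain j where j: "j \<in> J" "f j = P" using P J(3) by (metis imageE)
    then have "fib I P = insert j (fib I' P)" "j \<notin> fib I' P"
      using J(1,2) by (auto simp: fib_def I'_def inj_on_def)
    then show ?thesis using fin(3)[of P] by simp
  qed
  \<comment> \<open>Removing \<open>J\<close> lowers every multiplicity by one, so layers shift by
    one; \<open>k \<ge> 1\<close> excludes the pairs that were used up.\<close>
  have layer: "{P \<in> f ` I. Suc k \<le> card (fib I P)} = {P \<in> f ` I'. k \<le> card (fib I' P)}" if "k \<ge> 1" for k
  proof -
    have "P \<in> f ` I'" if "k \<le> card (fib I' P)" for P
    proof -
      have "fib I' P \<noteq> {}" using that \<open>k \<ge> 1\<close> by auto
      then show ?thesis by (auto simp: fib_def)
    qed
    moreover have "f ` I' \<subseteq> f ` I" by (auto simp: I'_def)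
    ultimately show ?thesis using fib by auto
  qed
  have "{P \<in> f ` I. 1 \<le> card (fib I P)} = f ` J" using fib J(3) by auto
  then have T1: "T I 1 = (\<Sum>i = 1..card J. i)" unfolding T_def by (simp only: card_image[OF J(2)])
  have TS: "T I (Suc k) = T I' k" if "k \<ge> 1" for k unfolding T_def layer[OF that] ..
  define t where "t = (\<Sum>i = 1..card J. i)"
  define t' where "t' = (\<Sum>k = 1..K. T I' k)"
  have total: "(\<Sum>k = 1..Suc K. T I k) = t + t'"
  proof -
    have "(\<Sum>k = 1..Suc K. T I k) = T I 1 + (\<Sum>k = Suc 1..Suc K. T I k)"
      by (rule sum.atLeast_Suc_atMost) simp
    also have "(\<Sum>k = Suc 1..Suc K. T I k) = (\<Sum>k = 1..K. T I (Suc k))"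
      by (rule sum.atLeast_Suc_atMost_Suc_shift[unfolded comp_def])
    also have "\<dots> = t'" unfolding t'_def using TS by (intro sum.cong) auto
    finally show ?thesis unfolding T1 t_def .
  qed
  have IH: "min CARD('p) (1 + t') \<le> card (sum s ` Pow I')"
    using Suc.IH[of I'] Suc.prems fin(2) fib unfolding t'_def T_def fib_def[symmetric]
    by (auto simp: I'_def fib_def)
  have s_inj: "inj_on s J"
    using J(2) by (auto simp: inj_on_def f_def)
  have antisym: "s ` J \<inter> uminus ` s ` J = {}"
  proof -
    have False if "i \<in> J" "j \<in> J" "s i = - s j" for i j
    proof -
      have "f i = f j" using that(3) by (auto simp: f_def)
      then have "i = j" using J(2) that by (auto simp: inj_on_def)
      then have "of_nat 2 * s i = 0"
        using that(3) by (metis mult_2 of_nat_numeral add.right_inverse)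
      moreover have "s i \<noteq> 0" using that J(1) Suc.prems(2) by auto
      ultimately have "CARD('p) dvd 2" using of_nat_0_mod_ring_dvd[of 2, where ?'a = 'p] by simp
      then show False using odd prime_card[where ?'a = 'p] by (metis even_numeral primes_dvd_imp_eq two_is_prime_nat)
    qed
    then show ?thesis by auto
  qed
  have set_bound: "min CARD('p) (1 + t) \<le> card (sum s ` Pow J)" "min CARD('p) t \<le> card (sum s ` (Pow J - {{}}))"
  proof -
    have sum_eq: "sum s L = \<Sum>(s ` L)" if "L \<subseteq> J" for L
      using inj_on_subset[OF s_inj that] by (simp add: sum.reindex)
    have "Sum ` Pow (s ` J) = sum s ` Pow J"
      unfolding image_Pow_surj[OF refl, of s J, symmetric] image_image using sum_eq by (intro image_cong) auto
    moreover have "Pow (s ` J) - {{}} = (`) s ` (Pow J - {{}})"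
      unfolding image_Pow_surj[OF refl, of s J, symmetric] by auto
    then have "Sum ` (Pow (s ` J) - {{}}) = sum s ` (Pow J - {{}})"
      using sum_eq by (auto simp: image_image intro!: image_cong)
    ultimately show "min CARD('p) (1 + t) \<le> card (sum s ` Pow J)" "min CARD('p) t \<le> card (sum s ` (Pow J - {{}}))"
      using card_set_subset_sums[OF antisym] by (simp_all add: t_def card_image[OF s_inj])
  qed
  have add: "sum s L + sum s L' = sum s (L \<union> L')" if "L \<subseteq> J" "L' \<subseteq> I'" for L L'
    using that fin by (intro sum.union_disjoint[symmetric]) (auto simp: I'_def intro: finite_subset)
  have sub: "(\<lambda>(a, b). a + b) ` (sum s ` Pow J \<times> sum s ` Pow I') \<subseteq> sum s ` Pow I"
    "(\<lambda>(a, b). a + b) ` (sum s ` (Pow J - {{}}) \<times> sum s ` Pow I') \<subseteq> sum s ` (Pow I - {{}})"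
    using J(1) by (auto simp: add I'_def intro!: imageI dest: subsetD) blast+
  have p: "CARD('p) > 0" by simp
  have "min CARD('p) (card (sum s ` Pow J) + card (sum s ` Pow I') - 1) \<le> card (sum s ` Pow I)"
    using cauchy_davenport[of "sum s ` Pow J" "sum s ` Pow I'"] card_mono[OF _ sub(1)] by fastforce
  then have "min CARD('p) (1 + (t + t')) \<le> card (sum s ` Pow I)"
    using set_bound(1) IH p by linarith
  \<comment> \<open>Only the part from \<open>J\<close> must be nonempty; any subset of
    \<open>I'\<close> may be added. So \<open>t\<close> combines with \<open>1 + t'\<close>, and
    Cauchy-Davenport loses 1.\<close>
  moreover have "min CARD('p) (t + t') \<le> card (sum s ` (Pow I - {{}}))"
  proof (cases "J = {}")
    case True
    then have "I = {}" using J(3) by auto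
    then show ?thesis unfolding total[symmetric] by (simp add: T_def)
  next
    case False
    then have "sum s ` (Pow J - {{}}) \<noteq> {}" by auto
    then have "min CARD('p) (card (sum s ` (Pow J - {{}})) + card (sum s ` Pow I') - 1) \<le> card (sum s ` (Pow I - {{}}))"
      and "card (sum s ` (Pow J - {{}})) > 0"
      using cauchy_davenport[of "sum s ` (Pow J - {{}})" "sum s ` Pow I'"] card_mono[OF _ sub(2)]
      by (fastforce simp: card_gt_0_iff)+
    then show ?thesis using set_bound(2) IH p by linarith
  qed
  ultimately show ?case unfolding total[symmetric] T_def fib_def by simp
qed

section \<open>From layers to the ordered list of common multiplicities\<close>

text \<open>Double counting: appending a smallest entry \<open>x\<close> at position
  \<open>n + 1\<close> adds \<open>n + 1\<close> to each of the layers \<open>1, ..., x\<close>,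
  which contain all earlier entries, and leaves the higher layers unchanged.\<close>

lemma weighted_sum_eq_sum_layers:
  fixes l :: "nat list"
  assumes "sorted_wrt (\<ge>) l" "\<And>x. x \<in> set l \<Longrightarrow> x \<le> K"
  shows "(\<Sum>i = 1..length l. i * l ! (i - 1)) = (\<Sum>k = 1..K. \<Sum>i = 1..length (filter (\<lambda>x. k \<le> x) l). i)"
  using assms
proof (induction l rule: rev_induct)
  case Nil
  then show ?case by simp
next
  case (snoc x l)
  let ?n = "length l"
  have x: "x \<le> K" "\<And>y. y \<in> set l \<Longrightarrow> x \<le> y" using snoc.prems by (auto simp: sorted_wrt_append)
  have "(\<Sum>i = 1..length (l @ [x]). i * (l @ [x]) ! (i - 1)) = (\<Sum>i = 1..?n. i * (l @ [x]) ! (i - 1)) + Suc ?n * x"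
    by simp
  also have "(\<Sum>i = 1..?n. i * (l @ [x]) ! (i - 1)) = (\<Sum>i = 1..?n. i * l ! (i - 1))"
    by (intro sum.cong) (auto simp: nth_append)
  also have "\<dots> = (\<Sum>k = 1..K. \<Sum>i = 1..length (filter (\<lambda>x. k \<le> x) l). i)"
    using snoc.prems by (intro snoc.IH) (auto simp: sorted_wrt_append)
  also have "Suc ?n * x = (\<Sum>k = 1..K. if k \<in> {1..x} then Suc ?n else 0)"
  proof -
    have "(\<Sum>k = 1..K. if k \<in> {1..x} then Suc ?n else 0) = (\<Sum>k\<in>{1..K} \<inter> {1..x}. Suc ?n)"
      by (rule sum.inter_restrict[symmetric]) simp
    also have "{1..K} \<inter> {1..x} = {1..x}" using x(1) by auto
    finally show ?thesis by simp
  qed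
  also have "(\<Sum>k = 1..K. \<Sum>i = 1..length (filter (\<lambda>x. k \<le> x) l). i) + (\<Sum>k = 1..K. if k \<in> {1..x} then Suc ?n else 0)
      = (\<Sum>k = 1..K. \<Sum>i = 1..length (filter (\<lambda>x. k \<le> x) (l @ [x])). i)"
    unfolding sum.distrib[symmetric]
  proof (intro sum.cong refl)
    fix k assume k: "k \<in> {1..K}"
    show "(\<Sum>i = 1..length (filter (\<lambda>x. k \<le> x) l). i) + (if k \<in> {1..x} then Suc ?n else 0)
        = (\<Sum>i = 1..length (filter (\<lambda>x. k \<le> x) (l @ [x])). i)"
    proof (cases "k \<le> x")
      case True
      then have "filter (\<lambda>x. k \<le> x) l = l" using x(2) by (intro filter_True) (auto intro: order.trans)
      then show ?thesis using True k by simp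
    qed simp
  qed
  finally show ?case .
qed

lemma common_multiplicity_eq_card:
  "common_multiplicity S {x, - x} = card {i \<in> {..<length S}. {S ! i, - S ! i} = {x, - x :: 'a :: ab_group_add}}"
proof -
  have "count_list S y = card {i \<in> {..<length S}. S ! i = y}" for y
    by (simp add: count_list_eq_length_filter length_filter_conv_card eq_commute)
  then have "common_multiplicity S {x, - x} = (\<Sum>y\<in>{x, - x}. card {i \<in> {..<length S}. S ! i = y})"
    by (simp add: common_multiplicity_def)
  also have "\<dots> = card (\<Union>y\<in>{x, - x}. {i \<in> {..<length S}. S ! i = y})"
    by (intro card_UN_disjoint[symmetric]) auto
  also have "(\<Union>y\<in>{x, - x}. {i \<in> {..<length S}. S ! i = y}) = {i \<in> {..<length S}. {S ! i, - S ! i} = {x, - x}}"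
    by (auto simp: doubleton_eq_iff minus_equation_iff)
  finally show ?thesis .
qed

theorem theorem6:
  fixes S :: "'p :: prime_card mod_ring list" and l :: "nat list"
  assumes "odd CARD('p)"
    and "0 \<notin> set S"
    and "mset l = image_mset (common_multiplicity S) (mset_set (opposite_pairs S))"
    and "sorted_wrt (\<ge>) l"
  shows "card (subset_sums S) \<ge> min CARD('p) (1 + (\<Sum>i = 1..length l. i * l ! (i - 1)))
       \<and> card (nonempty_subset_sums S) \<ge> min CARD('p) (\<Sum>i = 1..length l. i * l ! (i - 1))"
proof -
  let ?I = "{..<length S}"
  define f where "f i = {S ! i, - S ! i}" for i
  have pairs: "opposite_pairs S = f ` ?I"
    by (auto simp: opposite_pairs_def f_def in_set_conv_nth image_iff Bex_def)
  have mult: "common_multiplicity S P = card {i \<in> ?I. f i = P}" if "P \<in> f ` ?I" for P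
    using that unfolding f_def by (auto simp: common_multiplicity_eq_card)
  have le: "card {i \<in> ?I. f i = P} \<le> length S" for P
    using card_mono[of ?I "{i \<in> ?I. f i = P}"] by auto
  have "set l = common_multiplicity S ` f ` ?I"
    using arg_cong[OF assms(3), of set_mset] by (simp add: pairs)
  then have l_le: "x \<le> length S" if "x \<in> set l" for x
    using that le mult by auto
  have filter_l: "length (filter (\<lambda>x. k \<le> x) l) = card {P \<in> f ` ?I. k \<le> card {i \<in> ?I. f i = P}}" for k
  proof -
    have "length (filter (\<lambda>x. k \<le> x) l) = size (filter_mset (\<lambda>x. k \<le> x) (mset l))"
      by (metis mset_filter size_mset)
    also have "\<dots> = card {P \<in> f ` ?I. k \<le> common_multiplicity S P}"
      by (simp add: assms(3) pairs filter_mset_image_mset)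
    also have "{P \<in> f ` ?I. k \<le> common_multiplicity S P} = {P \<in> f ` ?I. k \<le> card {i \<in> ?I. f i = P}}"
      using mult by auto
    finally show ?thesis .
  qed
  have sums: "subset_sums S = sum ((!) S) ` Pow ?I" "nonempty_subset_sums S = sum ((!) S) ` (Pow ?I - {{}})"
    by (auto simp: subset_sums_def nonempty_subset_sums_def)
  have "S ! i \<noteq> 0" if "i \<in> ?I" for i using assms(2) that by (metis lessThan_iff nth_mem)
  \<comment> \<open>\<open>length S\<close> serves as \<open>K\<close>, since it bounds every common
    multiplicity.\<close>
  then have "min CARD('p) (1 + (\<Sum>k = 1..length S. \<Sum>i = 1..card {P \<in> f ` ?I. k \<le> card {i \<in> ?I. f i = P}}. i)) \<le> card (subset_sums S)
    \<and> min CARD('p) (\<Sum>k = 1..length S. \<Sum>i = 1..card {P \<in> f ` ?I. k \<le> card {i \<in> ?I. f i = P}}. i) \<le> card (nonempty_subset_sums S)"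
    unfolding sums f_def using le by (intro card_indexed_subset_sums assms(1)) (auto simp: f_def)
  moreover have "(\<Sum>i = 1..length l. i * l ! (i - 1)) = (\<Sum>k = 1..length S. \<Sum>i = 1..card {P \<in> f ` ?I. k \<le> card {i \<in> ?I. f i = P}}. i)"
    using weighted_sum_eq_sum_layers[OF assms(4), of "length S"] l_le unfolding filter_l by blast
  ultimately show ?thesis by simp
qed

end
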